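(* Let $q \ge 6$ be a positive integer which is not a prime power. Then there are at most finitely many perfect $2$-error correcting codes over an alphabet of size $q$ (where the word length $n$ is allowed to vary over all positive integers).
   Context: Let $q \ge 2$, $e \ge 1$ be integers and let $Z_q$ be a set with $q$ elements (the alphabet). An $e$-error correcting code $C$ with parameters $(n,M)$ is a subset of $Z_q^n$ of size $M$ such that any two distinct elements of $C$ differ in at least $2e+1$ coordinates. The code is called perfect if $M\sum_{j=0}^{e}\binom{n}{j}(q-1)^j = q^n$. *)

theory Defs
  imports "HOL-Number_Theory.Prime_Powers" "HOL-Library.NList"
begin

text \<open>Only meaningful for words of equal length.\<close>

definition hamming_dist :: "'a list \<Rightarrow> 'a list \<Rightarrow> nat" where
  "hamming_dist x y = card {i. i < length x \<and> x ! i \<noteq> y ! i}"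

text \<open>
  The alphabet is a finite set \<open>Z\<close> (its size is the \<open>q\<close> of a \<open>q\<close>-ary code), and \<open>Z\<^sup>n\<close> is
  the set \<^term>\<open>nlists n Z\<close> of lists of length \<open>n\<close> over \<open>Z\<close>.
\<close>

definition error_correcting_code :: "'a set \<Rightarrow> nat \<Rightarrow> nat \<Rightarrow> nat \<Rightarrow> 'a list set \<Rightarrow> bool" where
  "error_correcting_code Z e n M C \<longleftrightarrow>
     C \<subseteq> nlists n Z \<and> card C = M \<and>
     (\<forall>x\<in>C. \<forall>y\<in>C. x \<noteq> y \<longrightarrow> 2 * e + 1 \<le> hamming_dist x y)"

text \<open>For nonempty \<open>Z\<close> the natural-number subtraction below does not truncate.\<close>

definition perfect_code :: "'a set \<Rightarrow> nat \<Rightarrow> nat \<Rightarrow> nat \<Rightarrow> 'a list set \<Rightarrow> bool" where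
  "perfect_code Z e n M C \<longleftrightarrow>
     error_correcting_code Z e n M C \<and>
     M * (\<Sum>j=0..e. (n choose j) * (card Z - 1) ^ j) = card Z ^ n"

end

theory Submission
  imports Defs "HOL-Library.FuncSet" "HOL-Library.Infinite_Set" "HOL-Computational_Algebra.Squarefree"
begin

text \<open>
  If a perfect code of length \<open>n\<close> exists, then the size \<open>V\<close> of a ball of radius \<open>2\<close> divides \<open>q ^ n\<close>.
  Completing the square gives \<open>Y\<^sup>2 = D + 8 * V\<close> with \<open>Y = 2 * (q - 1) * n - (q - 3)\<close> and
  \<open>D = (q - 3)\<^sup>2 - 8 > 0\<close>. Writing \<open>V = a * w\<^sup>2\<close> with \<open>a\<close> squarefree leaves finitely many equations
  \<open>Y\<^sup>2 = D + b * w\<^sup>2\<close> in which every prime factor of \<open>w\<close> divides \<open>q\<close>.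

  Such an equation has finitely many solutions by Thue's method. A solution \<open>(Y0, w0)\<close> gives the
  approximation \<open>Y0 / w0\<close> of \<open>sqrt b\<close>. If there were infinitely many, one could fix a large \<open>w0\<close>
  and a far larger \<open>w\<close> whose prime exponents are nearly proportional to those of \<open>w0\<close>. An unbalanced
  Pade approximation to the square root, evaluated at \<open>Y0\<^sup>2 / (b * w0\<^sup>2)\<close>, combines the two
  approximations into a nonzero rational number that is smaller than the reciprocal of its denominator.
\<close>

section \<open>Divided differences of exponentials\<close>

text \<open>The divided difference of \<open>t \<mapsto> exp (t * x)\<close> at the nodes
  \<open>E\<close>, in Lagrange form. As a function of \<open>x\<close> it is an exponential
  polynomial that vanishes at \<open>0\<close> to order \<open>card E - 1\<close>.\<close>

definition exp_divdiff :: "nat set \<Rightarrow> real \<Rightarrow> real" where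
  "exp_divdiff E x = (\<Sum>e\<in>E. exp (real e * x) / (\<Prod>f\<in>E - {e}. real e - real f))"

text \<open>Dropping the node \<open>a\<close> cancels one factor in every other denominator, and
  the term \<open>e = a\<close> is zero. Divided differences with a node removed can thus be
  compared over one index set.\<close>

lemma exp_divdiff_extend:
  assumes "finite E" "a \<in> E"
  shows "exp_divdiff (E - {a}) x =
           (\<Sum>e\<in>E. (real e - real a) * (exp (real e * x) / (\<Prod>f\<in>E - {e}. real e - real f)))"
proof -
  have "exp_divdiff (E - {a}) x =
          (\<Sum>e\<in>E - {a}. (real e - real a) * (exp (real e * x) / (\<Prod>f\<in>E - {e}. real e - real f)))"
    unfolding exp_divdiff_def
  proof (rule sum.cong)
    fix e assume e: "e \<in> E - {a}"
    have "(\<Prod>f\<in>E - {e}. real e - real f) = (real e - real a) * (\<Prod>f\<in>E - {e} - {a}. real e - real f)"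
      using e assms by (intro prod.remove) auto
    moreover have "E - {e} - {a} = E - {a} - {e}" by auto
    ultimately show "exp (real e * x) / (\<Prod>f\<in>E - {a} - {e}. real e - real f) =
        (real e - real a) * (exp (real e * x) / (\<Prod>f\<in>E - {e}. real e - real f))"
      using e by simp
  qed simp
  also have "\<dots> = (\<Sum>e\<in>E. (real e - real a) * (exp (real e * x) / (\<Prod>f\<in>E - {e}. real e - real f)))"
    using assms by (simp add: sum.remove[of E a])
  finally show ?thesis .
qed

lemma exp_divdiff_recursion:
  assumes "finite E" "a \<in> E" "b \<in> E"
  shows "(real b - real a) * exp_divdiff E x = exp_divdiff (E - {a}) x - exp_divdiff (E - {b}) x"
proof -
  have "(real b - real a) * exp_divdiff E x =
      (\<Sum>e\<in>E. (real e - real a) * (exp (real e * x) / (\<Prod>f\<in>E - {e}. real e - real f)) -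
              (real e - real b) * (exp (real e * x) / (\<Prod>f\<in>E - {e}. real e - real f)))"
    unfolding exp_divdiff_def sum_distrib_left by (intro sum.cong refl) (simp add: algebra_simps add_divide_distrib diff_divide_distrib)
  also have "\<dots> = exp_divdiff (E - {a}) x - exp_divdiff (E - {b}) x"
    using assms by (simp add: exp_divdiff_extend sum_subtractf)
  finally show ?thesis .
qed

lemma exp_divdiff_singleton [simp]: "exp_divdiff {a} x = exp (real a * x)"
  by (simp add: exp_divdiff_def)

text \<open>At \<open>x = 0\<close> this is a divided difference of the constant \<open>1\<close>.
  The recursion reduces it to two nodes, where the terms cancel.\<close>

lemma exp_divdiff_0:
  assumes "finite E" "card E = Suc (Suc m)"
  shows "exp_divdiff E 0 = 0"
  using assms
proof (induction m arbitrary: E)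
  case 0
  then obtain a b where "E = {a, b}" "a \<noteq> b"
    by (auto simp: card_Suc_eq)
  then show ?case
    by (simp add: exp_divdiff_def insert_Diff_if field_simps)
next
  case (Suc m)
  obtain a E' where a: "E = insert a E'" "a \<notin> E'" "card E' = Suc (Suc m)"
    using Suc.prems(2) by (metis card_Suc_eq)
  then obtain b where b: "b \<in> E'" by fastforce
  have "(real b - real a) * exp_divdiff E 0 = 0"
    using Suc.IH[of "E - {a}"] Suc.IH[of "E - {b}"] Suc.prems a b
    by (subst exp_divdiff_recursion) auto
  then show ?case using a b by auto
qed

text \<open>Differentiation multiplies the term of node \<open>e\<close> by \<open>e - a\<close>,
  which deletes the node \<open>a\<close>. Induction on the number of nodes becomes
  possible.\<close>

lemma DERIV_exp_divdiff:
  assumes "finite E" "a \<in> E"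
  shows "((\<lambda>x. exp (- (real a * x)) * exp_divdiff E x) has_real_derivative
           exp (- (real a * x)) * exp_divdiff (E - {a}) x) (at x)"
proof -

  have D: "((\<lambda>x. exp_divdiff E x) has_real_derivative
      (\<Sum>e\<in>E. real e * (exp (real e * x) / (\<Prod>f\<in>E - {e}. real e - real f)))) (at x)"
    unfolding exp_divdiff_def times_divide_eq_right
    by (intro DERIV_sum DERIV_cdivide) (auto intro!: derivative_eq_intros)
  have "((\<lambda>x. exp (- (real a * x)) * exp_divdiff E x) has_real_derivative
      exp (- (real a * x)) * (\<Sum>e\<in>E. real e * (exp (real e * x) / (\<Prod>f\<in>E - {e}. real e - real f)))
      + exp (- (real a * x)) * (- real a) * exp_divdiff E x) (at x)"
    by (rule derivative_eq_intros D refl | simp)+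
  also have "exp (- (real a * x)) * (\<Sum>e\<in>E. real e * (exp (real e * x) / (\<Prod>f\<in>E - {e}. real e - real f)))
      + exp (- (real a * x)) * (- real a) * exp_divdiff E x = exp (- (real a * x)) * exp_divdiff (E - {a}) x"
    unfolding exp_divdiff_extend[OF assms] unfolding exp_divdiff_def
    by (simp add: sum_distrib_left algebra_simps sum_subtractf diff_divide_distrib sum_negf)
  finally show ?thesis .
qed

text \<open>By the mean value theorem for divided differences the value is
  \<open>exp (\<xi> * x) * x ^ m / fact m\<close> with \<open>\<xi>\<close> between \<open>0\<close>
  and \<open>N\<close>. The proof removes one node at a time and compares derivatives.\<close>

lemma exp_divdiff_bounds:
  assumes "card E = Suc m" "E \<subseteq> {..N}" "0 \<le> x"
  shows "x ^ m / fact m \<le> exp_divdiff E x" "exp_divdiff E x \<le> exp (real N * x) * (x ^ m / fact m)"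
proof -
  have "x ^ m / fact m \<le> exp_divdiff E x \<and> exp_divdiff E x \<le> exp (real N * x) * (x ^ m / fact m)"
    using assms
  proof (induction m arbitrary: E x)
    case 0
    then obtain a where "E = {a}" by (auto simp: card_Suc_eq)
    with 0 show ?case by (simp add: mult_right_mono)
  next
    case (Suc m)
    have fin: "finite E" using Suc.prems(1) card.infinite by fastforce
    obtain a where a: "a \<in> E" using Suc.prems(1) by fastforce
    have aN: "a \<le> N" using a Suc.prems by auto
    have c: "card (E - {a}) = Suc m" "E - {a} \<subseteq> {..N}"
      using Suc.prems a fin by auto
    note IH = Suc.IH[OF c]
    define g where "g = (\<lambda>x. exp (- (real a * x)) * exp_divdiff E x)"
    have g: "(g has_real_derivative exp (- (real a * y)) * exp_divdiff (E - {a}) y) (at y)" for y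
      unfolding g_def by (rule DERIV_exp_divdiff[OF fin a])
    have g0: "g 0 = 0" using exp_divdiff_0[OF fin Suc.prems(1)] by (simp add: g_def)
    have pow: "((\<lambda>x. x ^ Suc m / fact (Suc m)) has_real_derivative y ^ m / fact m) (at y)" for y :: real
    proof -
      have "((\<lambda>x. x ^ Suc m / fact (Suc m)) has_real_derivative real (Suc m) * y ^ m / fact (Suc m)) (at y)"
        by (intro DERIV_cdivide) (use DERIV_pow[of "Suc m" y] in simp)
      then show ?thesis by (simp add: fact_Suc del: of_nat_Suc)
    qed
    \<comment> \<open>\<open>l\<close>, and \<open>h\<close> below, are the claimed bounds times
      \<open>exp (- (real a * x))\<close>. Both vanish at \<open>0\<close>, as \<open>g\<close>
      does, and their derivatives deviate from the inductive bounds in the favourable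
      direction.\<close>
    define l where "l = (\<lambda>x. exp (- (real a * x)) * (x ^ Suc m / fact (Suc m)))"
    have l: "(l has_real_derivative exp (- (real a * y)) * (y ^ m / fact m)
              - real a * exp (- (real a * y)) * (y ^ Suc m / fact (Suc m))) (at y)" for y
      unfolding l_def by (rule derivative_eq_intros pow refl | simp add: mult_ac)+
    define h where "h = (\<lambda>x. exp (real (N - a) * x) * (x ^ Suc m / fact (Suc m)))"
    have h: "(h has_real_derivative exp (real (N - a) * y) * (y ^ m / fact m)
              + real (N - a) * exp (real (N - a) * y) * (y ^ Suc m / fact (Suc m))) (at y)" for y
      unfolding h_def by (rule derivative_eq_intros pow refl | simp add: mult_ac add_ac)+
    have "g 0 - l 0 \<le> g x - l x"
    proof (rule DERIV_nonneg_imp_nondecreasing[OF Suc.prems(3)])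
      fix y :: real assume y: "0 \<le> y" "y \<le> x"
      have "exp (- (real a * y)) * (y ^ m / fact m) \<le> exp (- (real a * y)) * exp_divdiff (E - {a}) y"
        using IH[OF y(1)] by (intro mult_left_mono) auto
      moreover have "0 \<le> real a * exp (- (real a * y)) * (y ^ Suc m / fact (Suc m))" using y by simp
      ultimately show "\<exists>z. ((\<lambda>x. g x - l x) has_real_derivative z) (at y) \<and> 0 \<le> z"
        using DERIV_diff[OF g l, of y] by fastforce
    qed
    then have A: "l x \<le> g x" using g0 by (simp add: l_def)
    have "h 0 - g 0 \<le> h x - g x"
    proof (rule DERIV_nonneg_imp_nondecreasing[OF Suc.prems(3)])
      fix y :: real assume y: "0 \<le> y" "y \<le> x"
      have "exp (- (real a * y)) * exp_divdiff (E - {a}) y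
          \<le> exp (- (real a * y)) * (exp (real N * y) * (y ^ m / fact m))"
        using IH[OF y(1)] by (intro mult_left_mono) auto
      also have "\<dots> = exp (real (N - a) * y) * (y ^ m / fact m)"
        using aN by (simp add: of_nat_diff algebra_simps flip: exp_add)
      finally have "exp (- (real a * y)) * exp_divdiff (E - {a}) y
          \<le> exp (real (N - a) * y) * (y ^ m / fact m)" .
      moreover have "0 \<le> real (N - a) * exp (real (N - a) * y) * (y ^ Suc m / fact (Suc m))" using y by simp
      ultimately show "\<exists>z. ((\<lambda>x. h x - g x) has_real_derivative z) (at y) \<and> 0 \<le> z"
        using DERIV_diff[OF h g, of y] by fastforce
    qed
    then have B: "g x \<le> h x" using g0 by (simp add: h_def)
    have e: "exp_divdiff E x = exp (real a * x) * g x"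
      by (simp add: g_def exp_minus)
    have "exp (real a * x) * l x = x ^ Suc m / fact (Suc m)"
      by (simp add: l_def exp_minus)
    moreover have "exp (real a * x) * h x = exp (real N * x) * (x ^ Suc m / fact (Suc m))"
      using aN by (simp add: h_def of_nat_diff algebra_simps flip: exp_add mult_exp_exp)
    ultimately show ?case unfolding e using A B
      by (metis exp_ge_zero mult_left_mono)
  qed
  then show "x ^ m / fact m \<le> exp_divdiff E x" "exp_divdiff E x \<le> exp (real N * x) * (x ^ m / fact m)"
    by auto
qed

section \<open>Integer coefficients for the approximation\<close>

text \<open>
  This is integrality of \<open>4 ^ h * (y / 2 gchoose h)\<close>. Passing from \<open>y\<close> to \<open>y + 2\<close> changes it by an
  integer, which leaves \<open>y = 0\<close> and \<open>y = -1\<close>; the latter gives a central binomial coefficient.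
\<close>

lemma fact_dvd_prod_step2:
  fixes y :: int
  shows "fact h dvd 2 ^ h * (\<Prod>j<h. y - 2 * int j)"
proof -
  \<comment> \<open>Raising \<open>y\<close> by 2 shifts the factors by one place, so the two
    products share all but one factor each.\<close>
  have step: "(\<Prod>j<Suc h. y + 2 - 2 * int j) - (\<Prod>j<Suc h. y - 2 * int j)
       = 2 * int (Suc h) * (\<Prod>j<h. y - 2 * int j)" for h and y :: int
  proof -
    have "(\<Prod>j<Suc h. y + 2 - 2 * int j) = (y + 2) * (\<Prod>j<h. y - 2 * int j)"
      by (subst prod.lessThan_Suc_shift) (simp add: algebra_simps)
    then show ?thesis by (simp add: algebra_simps)
  qed
  have dstep: "fact (Suc h) dvd 2 ^ Suc h * (\<Prod>j<Suc h. y + 2 - 2 * int j) \<longleftrightarrow>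
      fact (Suc h) dvd 2 ^ Suc h * (\<Prod>j<Suc h. y - 2 * int j)"
    if "\<And>y :: int. fact h dvd 2 ^ h * (\<Prod>j<h. y - 2 * int j)" for h and y :: int
  proof -
    obtain r where r: "2 ^ h * (\<Prod>j<h. y - 2 * int j) = fact h * r"
      using \<open>fact h dvd 2 ^ h * (\<Prod>j<h. y - 2 * int j)\<close> by (elim dvdE)
    have "2 ^ Suc h * (\<Prod>j<Suc h. y + 2 - 2 * int j)
        = 2 ^ Suc h * (\<Prod>j<Suc h. y - 2 * int j) + 4 * int (Suc h) * (2 ^ h * (\<Prod>j<h. y - 2 * int j))"
      using step[of y h] by (simp add: algebra_simps)
    also have "4 * int (Suc h) * (2 ^ h * (\<Prod>j<h. y - 2 * int j)) = fact (Suc h) * (4 * r)"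
      unfolding r by (simp add: algebra_simps)
    finally show ?thesis by (simp only: dvd_add_left_iff dvd_triv_left)
  qed
  have m1: "fact h dvd 2 ^ h * (\<Prod>j<h. (-1) - 2 * int j)" for h
  proof -
    \<comment> \<open>Up to sign the product consists of the first \<open>h\<close> odd numbers, and
      \<open>2 ^ h * fact h\<close> supplies the even ones.\<close>
    have "(\<Prod>j<h. (-1) - 2 * int j) * (2 ^ h * fact h) = (-1) ^ h * (fact (2 * h))"
    proof (induction h)
      case (Suc h)
      have "(\<Prod>j<Suc h. (-1) - 2 * int j) * (2 ^ Suc h * fact (Suc h)) =
          ((\<Prod>j<h. (-1) - 2 * int j) * (2 ^ h * fact h)) * ((-1 - 2 * int h) * (2 * (int h + 1)))"
        by (simp add: fact_Suc algebra_simps)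
      also have "\<dots> = (-1) ^ Suc h * fact (2 * Suc h)"
        unfolding Suc.IH by (simp add: fact_Suc algebra_simps)
      finally show ?case .
    qed simp
    moreover have "fact h * fact h dvd (fact (2 * h) :: int)"
      using fact_fact_dvd_fact[of h h] by (simp add: mult_2)
    ultimately have "fact h * fact h dvd fact h * (2 ^ h * (\<Prod>j<h. (-1) - 2 * int j))"
      by (simp add: mult_ac)
    then show ?thesis by simp
  qed
  show ?thesis
  proof (induction h arbitrary: y)
    case (Suc h)
    let ?P = "\<lambda>y. fact (Suc h) dvd 2 ^ Suc h * (\<Prod>j<Suc h. y - 2 * int j)"
    note d = dstep[OF Suc.IH]
    have all: "?P (r + 2 * i)" if "?P r" for r i :: int
    proof (induction i rule: int_induct[where k = 0])
      case base then show ?case using that by simp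
    next
      case (step1 i) then show ?case using d[of "r + 2 * i"] by (simp add: algebra_simps)
    next
      case (step2 i) then show ?case using d[of "r + 2 * (i - 1)"] by (simp add: algebra_simps)
    qed
    show ?case
    proof (cases "even y")
      case True
      have "(\<Prod>j<Suc h. 0 - 2 * int j) = 0" by (rule prod_zero) auto
      then have "?P 0" by (metis dvd_0_right mult_zero_right)
      from all[OF this, of "y div 2"] True show ?thesis by simp
    next
      case False
      then have "y = -1 + 2 * ((y + 1) div 2)" by presburger
      then show ?thesis using all[OF m1, of "(y + 1) div 2"] by metis
    qed
  qed simp
qed

text \<open>For consecutive nodes the Lagrange denominators are, up to sign, \<open>fact N\<close>
  divided by binomial coefficients.\<close>

lemma prod_diff_atMost_remove:
  assumes "e \<le> N"
  shows "(\<Prod>f\<in>{..N} - {e}. real e - real f) = (-1) ^ (N - e) * (fact e * fact (N - e))"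
  using assms
proof (induction N rule: dec_induct)
  case base
  have "{..e} - {e} = {..<e}" by auto
  moreover have "(\<Prod>f<e. real e - real f) = fact e"
    by (simp add: fact_prod_rev atLeast0LessThan of_nat_diff)
  ultimately show ?case by simp
next
  case (step N)
  have "{..Suc N} - {e} = insert (Suc N) ({..N} - {e})" using step by auto
  then have "(\<Prod>f\<in>{..Suc N} - {e}. real e - real f)
      = (real e - real (Suc N)) * ((-1) ^ (N - e) * (fact e * fact (N - e)))"
    using step.IH by simp
  also have "\<dots> = (-1) ^ (Suc N - e) * (fact e * fact (Suc N - e))"
    using step by (simp add: Suc_diff_le fact_Suc of_nat_diff algebra_simps)
  finally show ?case .
qed

text \<open>One term of the exponential series. It serves to bound \<open>N ^ h / fact h\<close> by
  an exponential in \<open>N\<close>.\<close>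

lemma power_le_fact_mult_exp:
  fixes x :: real
  assumes "0 \<le> x"
  shows "x ^ h \<le> fact h * exp x"
proof -
  have "(\<Sum>n\<in>{h}. x ^ n /\<^sub>R fact n) \<le> (\<Sum>n. x ^ n /\<^sub>R fact n)"
    using assms by (intro sum_le_suminf summable_exp_generic) auto
  then show ?thesis by (simp add: exp_def field_simps)
qed

lemma sum_atMost_even_odd:
  "(\<Sum>e\<le>2 * K + 1. f e) = (\<Sum>i\<le>K. f (2 * i)) + (\<Sum>i\<le>K. f (2 * i + 1))" for f :: "nat \<Rightarrow> real"
  by (induction K) (simp_all add: algebra_simps)

text \<open>
  Up to scaling, the \<open>c\<close> below are the coefficients of the divided difference with nodes
  \<open>0, 2, \<dots>, 2 * k\<close> and \<open>1, 3, \<dots>, 2 * (k + h) + 1\<close>. Read with \<open>s = exp x\<close>, the two sums are the two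
  halves of a Pade approximation to the square root \<open>s\<close> of \<open>s\<^sup>2\<close>.
\<close>

lemma integral_exp_divdiff:
  fixes k h :: nat
  defines "N \<equiv> 2 * (k + h) + 1"
  obtains c :: "nat \<Rightarrow> int"
  where "\<And>e. \<bar>real_of_int (c e)\<bar> \<le> 16 ^ N"
    and "\<And>x :: real. 0 \<le> x \<Longrightarrow>
          x ^ (N - h) \<le> (\<Sum>i\<le>k. c (2 * i) * exp x ^ (2 * i)) + (\<Sum>i\<le>k + h. c (2 * i + 1) * exp x ^ (2 * i + 1))"
    and "\<And>x :: real. 0 \<le> x \<Longrightarrow>
          (\<Sum>i\<le>k. c (2 * i) * exp x ^ (2 * i)) + (\<Sum>i\<le>k + h. c (2 * i + 1) * exp x ^ (2 * i + 1))
            \<le> 4 ^ N * exp x ^ N * x ^ (N - h)"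
proof -
  define G where "G = (\<lambda>j. 2 * (k + 1 + j)) ` {..<h}"
  define E where "E = {..N} - G"
  \<comment> \<open>\<open>fact N\<close> clears the Lagrange denominators of the full node set
    \<open>{..N}\<close>. The omitted nodes \<open>G\<close> leave a product of \<open>h\<close>
    numbers in steps of 2, and \<open>2 ^ h\<close> times it is divisible by \<open>fact h\<close>.
    Dividing by \<open>fact h\<close> keeps the coefficients of exponential size.\<close>
  define L :: real where "L = fact N * 2 ^ h / fact h"
  have G: "G \<subseteq> {..N}" "finite G" by (auto simp: G_def N_def)
  have cardG: "card G = h" unfolding G_def by (subst card_image) (auto simp: inj_on_def)
  have hN: "h \<le> N" by (simp add: N_def)
  have cardE: "card E = Suc (N - h)"
    using G cardG hN by (simp add: E_def card_Diff_subset Suc_diff_le)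
  have choose_le: "real (N choose i) \<le> 2 ^ N" for i
    using binomial_le_pow2[of N i] by (metis of_nat_le_iff of_nat_numeral of_nat_power)
  have int: "\<exists>z :: int. L / (\<Prod>f\<in>E - {e}. real e - real f) = z \<and> \<bar>real_of_int z\<bar> \<le> 16 ^ N" if e: "e \<in> E" for e
  proof -
    have eN: "e \<le> N" "e \<notin> G" using e by (auto simp: E_def)
    let ?P = "\<Prod>j<h. (int e - 2 * int k - 2) - 2 * int j"
    have "{..N} - {e} = (E - {e}) \<union> G" "(E - {e}) \<inter> G = {}" using G eN by (auto simp: E_def)
    then have "(\<Prod>f\<in>{..N} - {e}. real e - real f)
        = (\<Prod>f\<in>E - {e}. real e - real f) * (\<Prod>f\<in>G. real e - real f)"
      using G by (simp add: prod.union_disjoint E_def)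
    moreover have "(\<Prod>f\<in>G. real e - real f) = (\<Prod>j<h. real e - real (2 * (k + 1 + j)))"
      unfolding G_def by (subst prod.reindex) (auto simp: inj_on_def)
    moreover have "(\<Prod>j<h. real e - real (2 * (k + 1 + j))) = real_of_int ?P"
      unfolding of_int_prod by (intro prod.cong) simp_all
    ultimately have P: "(\<Prod>f\<in>E - {e}. real e - real f) * ?P = (-1) ^ (N - e) * (fact e * fact (N - e))"
      using prod_diff_atMost_remove[OF eN(1)] by simp
    obtain r where r: "2 ^ h * ?P = fact h * r" using fact_dvd_prod_step2[of h "int e - 2 * int k - 2"] by (elim dvdE)
    have rr: "2 ^ h * real_of_int ?P = fact h * real_of_int r"
      using arg_cong[OF r, of real_of_int] by simp
    let ?z = "(-1) ^ (N - e) * int (N choose e) * r"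
    have Q0: "(\<Prod>f\<in>E - {e}. real e - real f) \<noteq> 0" by (simp add: E_def)
    have bin: "real (N choose e) * (fact e * fact (N - e)) = fact N"
      using binomial_fact[OF eN(1), where ?'a = real] by simp
    have "L = real_of_int ?z * (\<Prod>f\<in>E - {e}. real e - real f)"
    proof -
      have "fact h * (real_of_int ?z * (\<Prod>f\<in>E - {e}. real e - real f))
          = (-1) ^ (N - e) * real (N choose e) * (2 ^ h * real_of_int ?P) * (\<Prod>f\<in>E - {e}. real e - real f)"
        unfolding rr by simp
      also have "\<dots> = (-1) ^ (N - e) * real (N choose e) * 2 ^ h * ((\<Prod>f\<in>E - {e}. real e - real f) * ?P)"
        by (simp only: mult_ac)
      also have "\<dots> = ((-1) ^ (N - e) * (-1) ^ (N - e)) * (real (N choose e) * (fact e * fact (N - e))) * 2 ^ h"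
        unfolding P by (simp only: mult_ac)
      also have "\<dots> = fact N * 2 ^ h" unfolding bin by (simp flip: power_add mult_2)
      finally show ?thesis by (simp add: L_def field_simps)
    qed
    then have z: "L / (\<Prod>f\<in>E - {e}. real e - real f) = ?z" using Q0 by (simp add: field_simps)
    have P_le: "\<bar>real_of_int ?P\<bar> \<le> real N ^ h"
    proof -
      have "\<bar>real_of_int ?P\<bar> = (\<Prod>j<h. \<bar>real_of_int (int e - 2 * int k - 2 - 2 * int j)\<bar>)"
        by (simp add: abs_prod)
      also have "\<dots> \<le> (\<Prod>j<h. real N)"
        using eN by (intro prod_mono) (auto simp: N_def)
      finally show ?thesis by simp
    qed
    have "fact h * \<bar>real_of_int r\<bar> = 2 ^ h * \<bar>real_of_int ?P\<bar>"
      using arg_cong[OF rr, of abs] by (simp add: abs_mult)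
    also have "\<dots> \<le> 2 ^ h * real N ^ h"
      by (rule mult_left_mono[OF P_le]) simp
    also have "\<dots> \<le> 2 ^ h * (fact h * exp (real N))"
      by (intro mult_left_mono power_le_fact_mult_exp) auto
    finally have "\<bar>real_of_int r\<bar> \<le> 2 ^ h * exp (real N)" by (simp add: field_simps)
    also have "\<dots> \<le> 2 ^ N * 3 ^ N"
    proof (intro mult_mono power_increasing hN)
      show "exp (real N) \<le> 3 ^ N"
        using power_mono[OF exp_le, of N] by (simp flip: exp_of_nat_mult)
    qed auto
    finally have r_le: "\<bar>real_of_int r\<bar> \<le> 2 ^ N * 3 ^ N" .
    from r_le choose_le[of e] have "real (N choose e) * \<bar>real_of_int r\<bar> \<le> 2 ^ N * (2 ^ N * 3 ^ N)"
      by (intro mult_mono) auto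
    also have "\<dots> = (2 * (2 * 3)) ^ N" by (simp only: power_mult_distrib)
    also have "\<dots> \<le> 16 ^ N" by (intro power_mono) auto
    finally have "\<bar>real_of_int ?z\<bar> \<le> 16 ^ N" by (simp add: abs_mult)
    with z show ?thesis by (intro exI[of _ ?z] conjI)
  qed
  then obtain c0 :: "nat \<Rightarrow> int" where c0:
    "\<forall>e\<in>E. L / (\<Prod>f\<in>E - {e}. real e - real f) = c0 e \<and> \<bar>real_of_int (c0 e)\<bar> \<le> 16 ^ N"
    by metis
  define c where "c e = (if e \<in> E then c0 e else 0)" for e
  have c: "L / (\<Prod>f\<in>E - {e}. real e - real f) = c e \<and> \<bar>real_of_int (c e)\<bar> \<le> 16 ^ N" if "e \<in> E" for e
    using c0 that by (simp add: c_def)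
  have sum_eq: "(\<Sum>i\<le>k. c (2 * i) * exp x ^ (2 * i)) + (\<Sum>i\<le>k + h. c (2 * i + 1) * exp x ^ (2 * i + 1))
       = L * exp_divdiff E x" for x
  proof -
    have "L * exp_divdiff E x = (\<Sum>e\<in>E. c e * exp x ^ e)"
      unfolding exp_divdiff_def sum_distrib_left
    proof (intro sum.cong refl)
      fix e assume "e \<in> E"
      then have "L / (\<Prod>f\<in>E - {e}. real e - real f) * exp (real e * x) = c e * exp x ^ e"
        using c[of e] by (simp only: exp_of_nat_mult)
      then show "L * (exp (real e * x) / (\<Prod>f\<in>E - {e}. real e - real f)) = c e * exp x ^ e"
        by simp
    qed
    also have "\<dots> = (\<Sum>e\<le>N. c e * exp x ^ e)"
      by (intro sum.mono_neutral_left) (auto simp: E_def c_def)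
    also have "\<dots> = (\<Sum>i\<le>k + h. c (2 * i) * exp x ^ (2 * i)) + (\<Sum>i\<le>k + h. c (2 * i + 1) * exp x ^ (2 * i + 1))"
      unfolding N_def by (rule sum_atMost_even_odd)
    also have "(\<Sum>i\<le>k + h. c (2 * i) * exp x ^ (2 * i)) = (\<Sum>i\<le>k. c (2 * i) * exp x ^ (2 * i))"
    proof (intro sum.mono_neutral_right ballI)
      fix i assume i: "i \<in> {..k + h} - {..k}"
      then have "2 * i = 2 * (k + 1 + (i - (k + 1)))" "i - (k + 1) < h" by auto
      then have "2 * i \<in> G" unfolding G_def by blast
      then show "c (2 * i) * exp x ^ (2 * i) = 0" by (simp add: c_def E_def)
    qed auto
    finally show ?thesis by simp
  qed
  \<comment> \<open>The scaled factor \<open>L / fact (N - h)\<close> lies between \<open>1\<close>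
    and \<open>4 ^ N\<close>, so no factorial survives in the final bounds.\<close>
  have LN: "L / fact (N - h) = real (N choose h) * 2 ^ h"
    using binomial_fact[OF hN, where ?'a = real] by (simp add: L_def field_simps)
  have "1 \<le> N choose h" using hN by (simp add: Suc_leI)
  then have "1 \<le> real (N choose h)" by linarith
  then have L1: "1 \<le> L / fact (N - h)" unfolding LN using mult_mono[of 1 "real (N choose h)" 1 "2 ^ h"] by simp
  have "real (N choose h) * 2 ^ h \<le> 2 ^ N * 2 ^ N"
    using choose_le[of h] hN by (intro mult_mono power_increasing) auto
  also have "\<dots> = (2 * 2) ^ N" by (simp only: power_mult_distrib)
  finally have L4: "L / fact (N - h) \<le> 4 ^ N" unfolding LN by simp
  have L0: "L \<ge> 0" by (simp add: L_def)
  have EN: "E \<subseteq> {..N}" by (auto simp: E_def)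
  show thesis
  proof (rule that[of c])
    show "\<bar>real_of_int (c e)\<bar> \<le> 16 ^ N" for e using c[of e] by (cases "e \<in> E") (auto simp: c_def)
    fix x :: real assume x: "0 \<le> x"
    note b = exp_divdiff_bounds[OF cardE EN x]
    have "1 * x ^ (N - h) \<le> (L / fact (N - h)) * x ^ (N - h)"
      using L1 x by (intro mult_right_mono) auto
    also have "\<dots> \<le> L * exp_divdiff E x" using mult_left_mono[OF b(1) L0] by simp
    finally show "x ^ (N - h) \<le> (\<Sum>i\<le>k. c (2 * i) * exp x ^ (2 * i))
        + (\<Sum>i\<le>k + h. c (2 * i + 1) * exp x ^ (2 * i + 1))" unfolding sum_eq by simp
    have "L * exp_divdiff E x \<le> (L / fact (N - h)) * (exp x ^ N * x ^ (N - h))"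
      using mult_left_mono[OF b(2) L0] by (simp add: exp_of_nat_mult)
    also have "\<dots> \<le> 4 ^ N * (exp x ^ N * x ^ (N - h))"
      using L4 x by (intro mult_right_mono) auto
    finally show "(\<Sum>i\<le>k. c (2 * i) * exp x ^ (2 * i)) + (\<Sum>i\<le>k + h. c (2 * i + 1) * exp x ^ (2 * i + 1))
         \<le> 4 ^ N * exp x ^ N * x ^ (N - h)" unfolding sum_eq by (simp add: mult.assoc)
  qed
qed

section \<open>Square roots and smooth denominators\<close>

text \<open>
  With \<open>s = Y0 / (w0 * sqrt b)\<close> and \<open>\<sigma> = Y / (w * sqrt b)\<close>, the Pade form \<open>A + B * s\<close> has size about
  \<open>w0 powr (- 12 * \<kappa>)\<close>, replacing \<open>A\<close> by \<open>A * \<sigma>\<close> changes it by about \<open>w0 powr (- 16 * \<kappa>)\<close>, and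
  \<open>sqrt b * (A * \<sigma> + B * s)\<close> is rational with denominator about \<open>w0 ^ (11 * \<kappa>)\<close>. The smallness
  of this denominator, where \<open>w0 ^ (18 * \<kappa>)\<close> would be expected, is what the divisibility buys.
\<close>

lemma pell_gap:
  fixes D b q w0 Y0 w Y \<kappa> u :: nat
  assumes pos: "D > 0" "b > 0" "w0 > 0" "w > 0" and \<kappa>: "\<kappa> \<ge> 9" and q: "q \<ge> 1"
    and eq0: "Y0\<^sup>2 = D + b * w0\<^sup>2" and eq: "Y\<^sup>2 = D + b * w\<^sup>2"
    and w_large: "w0 ^ (8 * \<kappa>) \<le> w * w0 ^ 8"
    and w_dvd: "w dvd w0 ^ (8 * \<kappa>) * q ^ u" and qu: "q ^ u \<le> q * w0 ^ \<kappa>"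
  shows "w0 < 2 ^ 46 * D ^ 7 * (4 * b) ^ 7 * q"
proof (rule ccontr)
  assume "\<not> w0 < 2 ^ 46 * D ^ 7 * (4 * b) ^ 7 * q"
  then have w0_ge: "2 ^ 46 * D ^ 7 * (4 * b) ^ 7 * q \<le> w0" by simp
  \<comment> \<open>Each size condition needed later bounds \<open>w0\<close> from below by a
    divisor of the large constant.\<close>
  have big: "r \<le> w0" if "r dvd 2 ^ 46 * D ^ 7 * (4 * b) ^ 7 * q" for r :: nat
    using dvd_imp_le[OF that] pos q w0_ge by auto
  define s where "s = Y0 / (w0 * sqrt b)"
  define \<sigma> where "\<sigma> = Y / (w * sqrt b)"
  define x where "x = ln s"
  have s2: "s\<^sup>2 = 1 + D / (b * w0\<^sup>2)"
  proof -
    have "s\<^sup>2 = real (Y0\<^sup>2) / (b * w0\<^sup>2)" by (simp add: s_def power_divide power_mult_distrib mult.commute)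
    then show ?thesis unfolding eq0 using pos by (simp add: field_simps)
  qed
  have \<sigma>2: "\<sigma>\<^sup>2 = 1 + D / (b * w\<^sup>2)"
  proof -
    have "\<sigma>\<^sup>2 = real (Y\<^sup>2) / (b * w\<^sup>2)" by (simp add: \<sigma>_def power_divide power_mult_distrib mult.commute)
    then show ?thesis unfolding eq using pos by (simp add: field_simps)
  qed
  have "2 * D \<le> w0"
    by (rule big) (auto intro!: dvd_mult2 mult_dvd_mono dvd_power simp: power_eq_if[of 2 46] dvd_triv_left)
  then have w0D: "2 * real D \<le> w0" by simp
  then have w0_2: "real w0 \<ge> 2" using pos by linarith
  \<comment> \<open>\<open>z\<close> is \<open>s ^ 2 - 1\<close>, so \<open>x\<close> is half of
    \<open>ln (1 + z)\<close> and lies between \<open>z / 4\<close> and \<open>z\<close>. Hence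
    \<open>x\<close> has order \<open>1 / w0 ^ 2\<close>.\<close>
  define z where "z = D / (b * real w0 ^ 2)"
  have z1: "1 / (b * real w0 ^ 2) \<le> z" unfolding z_def using pos by (intro divide_right_mono) auto
  have zD: "z \<le> D / real w0 ^ 2" unfolding z_def using pos by (intro divide_left_mono) auto
  have "D / real w0 ^ 2 \<le> 1 / 2"
  proof -
    have "2 * real D * 1 \<le> real w0 * real w0" using w0D w0_2 by (intro mult_mono) auto
    then show ?thesis using w0_2 by (simp add: field_simps power2_eq_square)
  qed
  then have z_half: "z \<le> 1 / 2" by (rule order_trans[OF zD])
  have z0: "z > 0" unfolding z_def using pos by simp
  have s2z: "s\<^sup>2 = 1 + z" using s2 by (simp add: z_def)
  have s0: "s > 0"
  proof -
    have "s \<ge> 0" by (simp add: s_def)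
    moreover have "s \<noteq> 0" using s2z z0 by auto
    ultimately show ?thesis by simp
  qed
  have s_le: "s \<le> 2" by (rule power2_le_imp_le) (use s2z z_half in auto)
  have exs: "exp x = s" using s0 by (simp add: x_def)
  have x_ln: "2 * x = ln (1 + z)" using ln_realpow[of s 2] s2z by (simp add: x_def)
  have x_le: "x \<le> D / real w0 ^ 2"
    using ln_add_one_self_le_self[of z] z0 zD x_ln by linarith
  have x_ge: "1 / (4 * real b * real w0 ^ 2) \<le> x"
  proof -
    have "z\<^sup>2 \<le> z / 2" using z0 z_half by (simp add: power2_eq_square)
    then have "z / 2 \<le> ln (1 + z)" using ln_one_plus_pos_lower_bound[of z] z0 z_half by linarith
    then have "z / 4 \<le> x" using x_ln by linarith
    have "1 / (4 * real b * real w0 ^ 2) = (1 / (b * real w0 ^ 2)) / 4" by simp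
    also have "\<dots> \<le> z / 4" by (rule divide_right_mono[OF z1]) simp
    also have "\<dots> \<le> x" by fact
    finally show ?thesis .
  qed
  have x0: "x \<ge> 0" using x_ge by (rule order_trans[rotated]) simp
  have \<sigma>1: "\<sigma> \<ge> 1"
  proof (rule power2_le_imp_le)
    show "1\<^sup>2 \<le> \<sigma>\<^sup>2" unfolding \<sigma>2 by simp
    show "\<sigma> \<ge> 0" by (simp add: \<sigma>_def)
  qed
  have \<sigma>_le: "\<sigma> - 1 \<le> D / real w ^ 2"
  proof -
    have "\<sigma> - 1 \<le> (\<sigma> - 1) * (\<sigma> + 1)" using \<sigma>1 mult_left_mono[of 1 "\<sigma> + 1" "\<sigma> - 1"] by simp
    also have "\<dots> = D / (b * w\<^sup>2)" using \<sigma>2 by (simp add: power2_eq_square algebra_simps)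
    also have "\<dots> \<le> D / real w ^ 2" using pos by (simp, intro divide_left_mono) auto
    finally show ?thesis .
  qed

  \<comment> \<open>The choice is \<open>k = \<kappa>\<close> and \<open>h = 4 * \<kappa>\<close>.
    Only \<open>A\<close> is multiplied by \<open>\<sigma>\<close>, whose denominator
    \<open>w\<close> costs about \<open>w0 ^ (8 * \<kappa>)\<close>. Its degree
    \<open>2 * \<kappa>\<close> in \<open>s\<close>, against \<open>10 * \<kappa>\<close> for
    \<open>B\<close>, balances the two denominators.\<close>
  define N where "N = 2 * (\<kappa> + 4 * \<kappa>) + 1"
  have N: "N = 10 * \<kappa> + 1" "N - 4 * \<kappa> = 6 * \<kappa> + 1" by (simp_all add: N_def)
  have five: "\<kappa> + 4 * \<kappa> = 5 * \<kappa>" by simp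
  obtain c :: "nat \<Rightarrow> int"
  where c16: "\<And>e. \<bar>real_of_int (c e)\<bar> \<le> 16 ^ N"
    and lo': "\<And>x :: real. 0 \<le> x \<Longrightarrow> x ^ (6 * \<kappa> + 1) \<le>
      (\<Sum>i\<le>\<kappa>. c (2 * i) * exp x ^ (2 * i)) + (\<Sum>i\<le>5 * \<kappa>. c (2 * i + 1) * exp x ^ (2 * i + 1))"
    and up': "\<And>x :: real. 0 \<le> x \<Longrightarrow>
      (\<Sum>i\<le>\<kappa>. c (2 * i) * exp x ^ (2 * i)) + (\<Sum>i\<le>5 * \<kappa>. c (2 * i + 1) * exp x ^ (2 * i + 1))
        \<le> 4 ^ N * exp x ^ N * x ^ (6 * \<kappa> + 1)"
    by (rule integral_exp_divdiff[of \<kappa> "4 * \<kappa>", folded N_def, unfolded N(2) five]) (rule that)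
  note lo = lo'[OF x0] and up = up'[OF x0]
  define A where "A = (\<Sum>i\<le>\<kappa>. c (2 * i) * s ^ (2 * i))"
  define B where "B = (\<Sum>i\<le>5 * \<kappa>. c (2 * i + 1) * s ^ (2 * i))"
  have Bs: "(\<Sum>i\<le>5 * \<kappa>. c (2 * i + 1) * exp x ^ (2 * i + 1)) = B * s"
    unfolding B_def exs sum_distrib_right by (intro sum.cong) auto
  have As: "(\<Sum>i\<le>\<kappa>. c (2 * i) * exp x ^ (2 * i)) = A" by (simp add: A_def exs)
  have F_lo: "x ^ (6 * \<kappa> + 1) \<le> A + B * s" using lo unfolding As Bs .
  have F_up: "A + B * s \<le> 4 ^ N * s ^ N * x ^ (6 * \<kappa> + 1)" using up[unfolded As Bs] unfolding exs .
  \<comment> \<open>The exponent collects \<open>\<kappa>\<close> for the number of terms,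
    \<open>\<kappa>\<close> for the powers of \<open>s\<close> and
    \<open>4 * N = 40 * \<kappa> + 4\<close> for the coefficients.\<close>
  have A_le: "\<bar>A\<bar> \<le> 2 ^ (42 * \<kappa> + 4)"
  proof -
    have "\<bar>A\<bar> \<le> (\<Sum>i\<le>\<kappa>. \<bar>c (2 * i) * s ^ (2 * i)\<bar>)" unfolding A_def by (rule sum_abs)
    also have "\<dots> \<le> (\<Sum>i\<le>\<kappa>. 16 ^ N * 2 ^ \<kappa>)"
    proof (intro sum_mono)
      fix i assume i: "i \<in> {..\<kappa>}"
      have "s ^ (2 * i) \<le> 2 ^ \<kappa>"
      proof -
        have "s ^ (2 * i) \<le> 2 ^ i"
          unfolding power_mult using s2z z_half z0 by (intro power_mono) auto
        also have "\<dots> \<le> 2 ^ \<kappa>" using i by (intro power_increasing) auto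
        finally show ?thesis .
      qed
      then show "\<bar>c (2 * i) * s ^ (2 * i)\<bar> \<le> 16 ^ N * 2 ^ \<kappa>"
        using s0 c16[of "2 * i"] unfolding abs_mult by (intro mult_mono) auto
    qed
    also have "\<dots> = (real \<kappa> + 1) * (16 ^ N * 2 ^ \<kappa>)" by simp
    also have "\<dots> \<le> 2 ^ \<kappa> * (16 ^ N * 2 ^ \<kappa>)"
    proof (rule mult_right_mono)
      have "\<kappa> + 1 \<le> 2 ^ \<kappa>" using less_exp[of \<kappa>] by (simp add: Suc_le_eq)
      then have "real (\<kappa> + 1) \<le> real (2 ^ \<kappa>)" by (rule of_nat_mono)
      then show "real \<kappa> + 1 \<le> 2 ^ \<kappa>" by simp
    qed auto
    also have "(16 :: real) ^ N = 2 ^ (4 * N)" by (simp add: power_mult)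
    also have "2 ^ \<kappa> * (2 ^ (4 * N) * 2 ^ \<kappa>) = (2 :: real) ^ (\<kappa> + 4 * N + \<kappa>)"
      by (simp only: power_add mult_ac)
    also have "\<kappa> + 4 * N + \<kappa> = 42 * \<kappa> + 4" unfolding N by simp
    finally show ?thesis .
  qed

  \<comment> \<open>The main term \<open>A + B * s\<close> dominates the perturbation coming from \<open>\<sigma> \<noteq> 1\<close>, so \<open>A * \<sigma> + B * s\<close> is
    nonzero, and no second approximant is needed.\<close>
  have dom: "\<bar>A\<bar> * (\<sigma> - 1) < x ^ (6 * \<kappa> + 1)"
  proof -
    have "2 ^ 46 * D * (4 * b) ^ 7 \<le> w0"
      by (rule big) (auto intro!: dvd_mult2 mult_dvd_mono dvd_power)
    then have "real (2 ^ 46 * D * (4 * b) ^ 7) \<le> real w0" by (rule of_nat_mono)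
    then have "2 ^ 46 * real D * (4 * real b) ^ 7 \<le> w0"
      by (simp only: of_nat_mult of_nat_power of_nat_numeral)
    then have "(2 ^ 46 * real D * (4 * real b) ^ 7) ^ \<kappa> \<le> real w0 ^ \<kappa>" by (intro power_mono) auto
    moreover have "2 ^ (42 * \<kappa> + 4) * real D * (4 * real b) ^ (6 * \<kappa> + 1) \<le> (2 ^ 46 * real D * (4 * real b) ^ 7) ^ \<kappa>"
    proof -
      have "2 ^ (42 * \<kappa> + 4) * real D * (4 * real b) ^ (6 * \<kappa> + 1) \<le> 2 ^ (46 * \<kappa>) * real D ^ \<kappa> * (4 * real b) ^ (7 * \<kappa>)"
        using pos \<kappa> by (intro mult_mono power_increasing self_le_power) auto
      then show ?thesis by (simp only: power_mult_distrib power_mult)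
    qed
    ultimately have 1: "2 ^ (42 * \<kappa> + 4) * real D * (4 * real b) ^ (6 * \<kappa> + 1) \<le> real w0 ^ \<kappa>" by linarith
    \<comment> \<open>As \<open>\<sigma> - 1\<close> is at most \<open>D / w ^ 2\<close>, the
      perturbation gains \<open>16 * \<kappa> - 16\<close> powers of \<open>w0\<close>, against
      \<open>12 * \<kappa> + 2\<close> in the main term. A further \<open>\<kappa>\<close> powers
      absorb the constants, and \<open>13 * \<kappa> + 18 < 16 * \<kappa>\<close> by
      \<open>\<kappa> \<ge> 9\<close>.\<close>
    have w0_split: "real w0 ^ (12 * \<kappa> + 18) = real w0 ^ 16 * real w0 ^ (12 * \<kappa> + 2)"
      unfolding power_add[symmetric] by (rule arg_cong[where f = "power (real w0)"]) simp
    have "2 ^ (42 * \<kappa> + 4) * real D * (4 * real b) ^ (6 * \<kappa> + 1) * real w0 ^ (12 * \<kappa> + 18) \<le> real w0 ^ \<kappa> * real w0 ^ (12 * \<kappa> + 18)"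
      using 1 by (intro mult_right_mono) auto
    also have "\<dots> < real w0 ^ (16 * \<kappa>)"
      unfolding power_add[symmetric] using w0_2 \<kappa> by (intro power_strict_increasing) auto
    also have "\<dots> \<le> (real w * real w0 ^ 8)\<^sup>2"
    proof -
      have "real w0 ^ (8 * \<kappa>) \<le> real w * real w0 ^ 8"
        using of_nat_mono[OF w_large, where ?'a = real] by (simp only: of_nat_mult of_nat_power)
      then have "(real w0 ^ (8 * \<kappa>))\<^sup>2 \<le> (real w * real w0 ^ 8)\<^sup>2" by (intro power_mono) auto
      then show ?thesis by (simp flip: power_mult)
    qed
    also have "\<dots> = real w ^ 2 * real w0 ^ 16" by (simp add: power_mult_distrib flip: power_mult)
    finally have "real w0 ^ 16 * (2 ^ (42 * \<kappa> + 4) * real D * (4 * real b) ^ (6 * \<kappa> + 1) * real w0 ^ (12 * \<kappa> + 2)) <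
        real w0 ^ 16 * real w ^ 2"
      unfolding w0_split by (simp only: mult_ac)
    then have 2: "2 ^ (42 * \<kappa> + 4) * real D * ((4 * real b) ^ (6 * \<kappa> + 1) * real w0 ^ (12 * \<kappa> + 2)) < real w ^ 2"
      using w0_2 by (simp add: mult.assoc)
    have "\<bar>A\<bar> * (\<sigma> - 1) \<le> 2 ^ (42 * \<kappa> + 4) * (D / real w ^ 2)"
      using A_le \<sigma>_le \<sigma>1 by (intro mult_mono) auto
    also have "\<dots> < 1 / ((4 * real b) ^ (6 * \<kappa> + 1) * real w0 ^ (12 * \<kappa> + 2))"
      using 2 pos by (simp add: field_simps)
    also have "\<dots> = (1 / (4 * real b * real w0 ^ 2)) ^ (6 * \<kappa> + 1)"
    proof -
      have "real w0 ^ (12 * \<kappa> + 2) = (real w0 ^ 2) ^ (6 * \<kappa> + 1)"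
        unfolding power_mult[symmetric] by (rule arg_cong[where f = "power (real w0)"]) simp
      then show ?thesis by (simp only: power_one_over power_mult_distrib of_nat_mult of_nat_power of_nat_numeral)
    qed
    also have "\<dots> \<le> x ^ (6 * \<kappa> + 1)" using x_ge by (intro power_mono) auto
    finally show ?thesis .
  qed
  define R where "R = A * \<sigma> + B * s"
  have R_eq: "R = (A + B * s) + A * (\<sigma> - 1)" by (simp add: R_def algebra_simps)
  have absA: "\<bar>A * (\<sigma> - 1)\<bar> = \<bar>A\<bar> * (\<sigma> - 1)" using \<sigma>1 by (simp add: abs_mult)
  have R_pos: "R > 0" using R_eq absA dom F_lo by linarith
  have R_le: "R \<le> 2 * (8 ^ N * x ^ (6 * \<kappa> + 1))"
  proof -
    have "4 ^ N * s ^ N * x ^ (6 * \<kappa> + 1) \<le> 4 ^ N * 2 ^ N * x ^ (6 * \<kappa> + 1)"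
      using s_le s0 x0 by (intro mult_right_mono mult_left_mono power_mono) auto
    also have "4 ^ N * 2 ^ N * x ^ (6 * \<kappa> + 1) = (4 * 2) ^ N * x ^ (6 * \<kappa> + 1)" by (simp only: power_mult_distrib)
    finally have "4 ^ N * s ^ N * x ^ (6 * \<kappa> + 1) \<le> 8 ^ N * x ^ (6 * \<kappa> + 1)" by simp
    then show ?thesis using R_eq absA dom F_lo F_up by linarith
  qed

  \<comment> \<open>A common denominator of \<open>sqrt b * A * \<sigma>\<close> and
    \<open>sqrt b * B * s\<close>. The powers of \<open>b\<close> and \<open>w0\<close> clear the
    second; in the first, \<open>w0 ^ (8 * \<kappa>) * q ^ u\<close> is a multiple of the
    denominator \<open>w\<close>.\<close>
  define \<Delta> where "\<Delta> = b ^ (5 * \<kappa>) * w0 ^ (10 * \<kappa> + 1) * q ^ u"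
  have b_sqrt: "sqrt b * sqrt b = b" "sqrt b \<noteq> 0" using pos by auto
  have s_pow: "s ^ (2 * i) = Y0 ^ (2 * i) / (b ^ i * w0 ^ (2 * i))" for i
  proof -
    have "s\<^sup>2 = Y0\<^sup>2 / (b * w0\<^sup>2)" by (simp add: s_def power_divide power_mult_distrib mult.commute)
    then show ?thesis by (simp add: power_mult power_divide power_mult_distrib)
  qed
  have int_A: "\<Delta> * sqrt b * (A * \<sigma>) \<in> \<int>"
  proof -
    obtain v where v: "w0 ^ (8 * \<kappa>) * q ^ u = w * v" using w_dvd by (elim dvdE)
    have "\<Delta> * (sqrt b * \<sigma>) * s ^ (2 * i) \<in> \<int>" if "i \<le> \<kappa>" for i
    proof -
      have "\<Delta> = b ^ (5 * \<kappa> - i) * b ^ i * (w0 ^ (2 * \<kappa> + 1 - 2 * i) * w0 ^ (2 * i)) * (w0 ^ (8 * \<kappa>) * q ^ u)"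
        using that unfolding \<Delta>_def by (simp flip: power_add)
      then have "real \<Delta> = real (b ^ (5 * \<kappa> - i) * w0 ^ (2 * \<kappa> + 1 - 2 * i) * v) * w * (b ^ i * w0 ^ (2 * i))"
        unfolding v by simp
      moreover have "sqrt b * \<sigma> = Y / w" using b_sqrt pos by (simp add: \<sigma>_def field_simps)
      ultimately have "\<Delta> * (sqrt b * \<sigma>) * s ^ (2 * i) =
          real (b ^ (5 * \<kappa> - i) * w0 ^ (2 * \<kappa> + 1 - 2 * i) * v * Y * Y0 ^ (2 * i))"
        using pos unfolding s_pow by simp
      then show ?thesis by (simp only: Ints_of_nat)
    qed
    then have "(\<Sum>i\<le>\<kappa>. c (2 * i) * (\<Delta> * (sqrt b * \<sigma>) * s ^ (2 * i))) \<in> \<int>"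
      by (intro Ints_sum Ints_mult[OF Ints_of_int]) auto
    also have "(\<Sum>i\<le>\<kappa>. c (2 * i) * (\<Delta> * (sqrt b * \<sigma>) * s ^ (2 * i))) = \<Delta> * sqrt b * (A * \<sigma>)"
      unfolding A_def sum_distrib_left sum_distrib_right by (intro sum.cong) auto
    finally show ?thesis .
  qed
  have int_B: "\<Delta> * sqrt b * (B * s) \<in> \<int>"
  proof -
    have "\<Delta> * (sqrt b * s) * s ^ (2 * i) \<in> \<int>" if "i \<le> 5 * \<kappa>" for i
    proof -
      have "\<Delta> = b ^ (5 * \<kappa> - i) * b ^ i * (w0 ^ (10 * \<kappa> - 2 * i) * w0 ^ (2 * i)) * w0 * q ^ u"
        using that unfolding \<Delta>_def by (simp flip: power_add)
      then have "real \<Delta> = real (b ^ (5 * \<kappa> - i) * w0 ^ (10 * \<kappa> - 2 * i) * q ^ u) * w0 * (b ^ i * w0 ^ (2 * i))"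
        by simp
      moreover have "sqrt b * s = Y0 / w0" using b_sqrt pos by (simp add: s_def field_simps)
      ultimately have "\<Delta> * (sqrt b * s) * s ^ (2 * i) =
          real (b ^ (5 * \<kappa> - i) * w0 ^ (10 * \<kappa> - 2 * i) * q ^ u * Y0 * Y0 ^ (2 * i))"
        using pos unfolding s_pow by simp
      then show ?thesis by (simp only: Ints_of_nat)
    qed
    then have "(\<Sum>i\<le>5 * \<kappa>. c (2 * i + 1) * (\<Delta> * (sqrt b * s) * s ^ (2 * i))) \<in> \<int>"
      by (intro Ints_sum Ints_mult[OF Ints_of_int]) auto
    also have "(\<Sum>i\<le>5 * \<kappa>. c (2 * i + 1) * (\<Delta> * (sqrt b * s) * s ^ (2 * i))) = \<Delta> * sqrt b * (B * s)"
      unfolding B_def sum_distrib_left sum_distrib_right by (intro sum.cong) auto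
    finally show ?thesis .
  qed
  have "\<Delta> * sqrt b * R \<in> \<int>"
    using Ints_add[OF int_A int_B] by (simp add: R_def algebra_simps)
  moreover have "\<Delta> * sqrt b * R > 0" using R_pos pos q by (simp add: \<Delta>_def)
  ultimately have ge1: "1 \<le> \<Delta> * sqrt b * R" by (auto elim!: Ints_cases)

  \<comment> \<open>The denominator costs at most \<open>11 * \<kappa> + 1\<close> powers of
    \<open>w0\<close>, and \<open>R\<close> saves \<open>12 * \<kappa> + 2\<close>. Of the
    \<open>\<kappa> + 1\<close> powers left, \<open>\<kappa>\<close> absorb the constants and the
    last one gives strictness.\<close>
  have "\<Delta> * sqrt b * R \<le> real (b ^ (5 * \<kappa>) * w0 ^ (10 * \<kappa> + 1) * (q * w0 ^ \<kappa>)) * real b *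
      (2 * (8 ^ N * (D / real w0 ^ 2) ^ (6 * \<kappa> + 1)))"
  proof (intro mult_mono)
    have "\<Delta> \<le> b ^ (5 * \<kappa>) * w0 ^ (10 * \<kappa> + 1) * (q * w0 ^ \<kappa>)"
      unfolding \<Delta>_def using qu by (intro mult_left_mono) auto
    then show "real \<Delta> \<le> real (b ^ (5 * \<kappa>) * w0 ^ (10 * \<kappa> + 1) * (q * w0 ^ \<kappa>))" by (rule of_nat_mono)
    show "sqrt b \<le> b" using pos by (intro real_le_lsqrt) (auto simp: power2_eq_square)
    have "2 * (8 ^ N * x ^ (6 * \<kappa> + 1)) \<le> 2 * (8 ^ N * (D / real w0 ^ 2) ^ (6 * \<kappa> + 1))"
      using x_le x0 by (intro mult_left_mono power_mono) auto
    with R_le show "R \<le> 2 * (8 ^ N * (D / real w0 ^ 2) ^ (6 * \<kappa> + 1))" by linarith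
  qed (use R_pos in auto)
  also have "\<dots> = (2 ^ (30 * \<kappa> + 4) * real b ^ (5 * \<kappa> + 1) * real D ^ (6 * \<kappa> + 1) * q) / real w0 ^ (\<kappa> + 1)"
  proof -
    define p r t where "p = real w0 ^ (10 * \<kappa> + 1)" and "r = real w0 ^ \<kappa>" and "t = real w0 ^ (\<kappa> + 1)"
    have nz: "p \<noteq> 0" "r \<noteq> 0" "t \<noteq> 0" using pos by (simp_all add: p_def r_def t_def)
    have "(D / real w0 ^ 2) ^ (6 * \<kappa> + 1) = real D ^ (6 * \<kappa> + 1) / real w0 ^ (2 * (6 * \<kappa> + 1))"
      by (simp only: power_divide power_mult)
    also have "2 * (6 * \<kappa> + 1) = (10 * \<kappa> + 1) + \<kappa> + (\<kappa> + 1)" by simp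
    also have "real w0 ^ ((10 * \<kappa> + 1) + \<kappa> + (\<kappa> + 1)) = p * r * t"
      by (simp only: power_add p_def r_def t_def)
    finally have Dw: "(D / real w0 ^ 2) ^ (6 * \<kappa> + 1) = real D ^ (6 * \<kappa> + 1) / (p * r * t)" .
    have U: "real (b ^ (5 * \<kappa>) * w0 ^ (10 * \<kappa> + 1) * (q * w0 ^ \<kappa>)) = real b ^ (5 * \<kappa>) * p * (q * r)"
      by (simp only: of_nat_mult of_nat_power p_def r_def)
    have "2 * (8 :: real) ^ N = 2 ^ (1 + 3 * N)" by (simp add: power_mult)
    also have "1 + 3 * N = 30 * \<kappa> + 4" unfolding N by simp
    finally have e8: "2 * (8 :: real) ^ N = 2 ^ (30 * \<kappa> + 4)" .
    have cancel: "\<beta> * p * (\<gamma> * r) * \<delta> * (2 * (\<epsilon> * (\<eta> / (p * r * t)))) = (2 * \<epsilon>) * (\<beta> * \<delta>) * \<eta> * \<gamma> / t"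
      for \<beta> \<gamma> \<delta> \<epsilon> \<eta> :: real
      using nz by (simp add: field_simps)
    show ?thesis unfolding Dw U cancel e8 t_def[symmetric] by (simp only: power_add power_one_right)
  qed
  also have "\<dots> < 1"
  proof -
    have "2 ^ 34 * b ^ 6 * D ^ 7 * q \<le> w0"
    proof (rule big)
      have "2 ^ 46 * D ^ 7 * (4 * b) ^ 7 * q = (2 ^ 34 * 2 ^ 12) * D ^ 7 * (4 ^ 7 * (b ^ 6 * b)) * q"
        unfolding power_mult_distrib power_Suc2[symmetric] power_add[symmetric] by simp
      also have "\<dots> = 2 ^ 34 * b ^ 6 * D ^ 7 * q * (2 ^ 12 * 4 ^ 7 * b)" by (simp only: mult_ac)
      finally show "2 ^ 34 * b ^ 6 * D ^ 7 * q dvd 2 ^ 46 * D ^ 7 * (4 * b) ^ 7 * q" by (metis dvd_triv_left)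
    qed
    then have "real (2 ^ 34 * b ^ 6 * D ^ 7 * q) \<le> real w0" by (rule of_nat_mono)
    then have "2 ^ 34 * real b ^ 6 * real D ^ 7 * q \<le> w0"
      by (simp only: of_nat_mult of_nat_power of_nat_numeral)
    then have "(2 ^ 34 * real b ^ 6 * real D ^ 7 * q) ^ \<kappa> \<le> real w0 ^ \<kappa>" by (intro power_mono) auto
    moreover have "2 ^ (30 * \<kappa> + 4) * real b ^ (5 * \<kappa> + 1) * real D ^ (6 * \<kappa> + 1) * q
        \<le> (2 ^ 34 * real b ^ 6 * real D ^ 7 * q) ^ \<kappa>"
    proof -
      have "2 ^ (30 * \<kappa> + 4) * real b ^ (5 * \<kappa> + 1) * real D ^ (6 * \<kappa> + 1) * q
          \<le> 2 ^ (34 * \<kappa>) * real b ^ (6 * \<kappa>) * real D ^ (7 * \<kappa>) * real q ^ \<kappa>"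
        using pos \<kappa> q by (intro mult_mono power_increasing self_le_power) auto
      then show ?thesis by (simp only: power_mult_distrib power_mult)
    qed
    moreover have "real w0 ^ \<kappa> < real w0 ^ (\<kappa> + 1)" using w0_2 by (intro power_strict_increasing) auto
    ultimately have "2 ^ (30 * \<kappa> + 4) * real b ^ (5 * \<kappa> + 1) * real D ^ (6 * \<kappa> + 1) * q < real w0 ^ (\<kappa> + 1)"
      by linarith
    moreover have "0 < real w0 ^ (\<kappa> + 1)" using pos by simp
    ultimately show ?thesis by (simp only: divide_less_eq_1_pos)
  qed
  finally show False using ge1 by simp
qed

section \<open>Prime exponents of smooth numbers\<close>

text \<open>The constant comes from \<open>ln 2 \<ge> 1 / 2\<close>. Exponents divided by
  \<open>ln w\<close> thus stay in a bounded range, as the pigeonhole argument needs.\<close>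

lemma multiplicity_le_ln:
  fixes p w :: nat
  assumes "prime p" "w > 0"
  shows "real (multiplicity p w) \<le> 2 * ln (real w)"
proof -
  have "p ^ multiplicity p w \<le> w"
    using assms(2) by (intro dvd_imp_le multiplicity_dvd) auto
  moreover have "2 ^ multiplicity p w \<le> p ^ multiplicity p w"
    using prime_ge_2_nat[OF assms(1)] by (intro power_mono) auto
  ultimately have "real (2 ^ multiplicity p w) \<le> real w" by (intro of_nat_mono) linarith
  then have "2 ^ multiplicity p w \<le> real w" by simp
  then have "ln (2 ^ multiplicity p w) \<le> ln (real w)"
    using assms(2) by (subst ln_le_cancel_iff) auto
  then have "real (multiplicity p w) * ln 2 \<le> ln (real w)" by (simp add: ln_realpow)
  moreover have "real (multiplicity p w) * (1 / 2) \<le> real (multiplicity p w) * ln 2"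
    using ln_le_minus_one[of "1 / 2 :: real"] by (intro mult_left_mono) (simp_all add: ln_div)
  ultimately show ?thesis by linarith
qed

text \<open>
  Pigeonhole on the direction of the exponent vector: if the exponents in \<open>w0\<close> and \<open>w\<close> are nearly
  proportional, then \<open>w\<close> divides the power of \<open>w0\<close> of its own size up to a factor \<open>q ^ u\<close>.
\<close>

lemma smooth_almost_dvd_power:
  fixes W :: "nat set" and q K :: nat
  assumes inf: "infinite W" and q: "q \<ge> 2" and smooth: "\<And>w. w \<in> W \<Longrightarrow> \<exists>k. w dvd q ^ k"
  obtains w0 w \<kappa> u where "w0 \<in> W" "w \<in> W" "w0 \<ge> K" "\<kappa> \<ge> 9"
    "w0 ^ (8 * \<kappa>) \<le> w * w0 ^ 8" "w dvd w0 ^ (8 * \<kappa>) * q ^ u" "q ^ u \<le> q * w0 ^ \<kappa>"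
proof -
  \<comment> \<open>Exponents are normalised by \<open>ln w\<close> and rounded to a grid of mesh
    \<open>1 / (8 * q)\<close>, fine enough for the final bound on \<open>q ^ u\<close>.\<close>
  define g :: "nat \<Rightarrow> nat \<Rightarrow> int" where
    "g w = (\<lambda>p\<in>prime_factors q. \<lfloor>8 * real q * real (multiplicity p w) / ln (real w)\<rfloor>)" for w
  define W1 where "W1 = W - {..1}"
  have inf1: "infinite W1" using inf by (simp add: W1_def)
  have W1: "w \<in> W" "w \<ge> 2" "ln (real w) > 0" if "w \<in> W1" for w
    using that by (auto simp: W1_def)
  have "g ` W1 \<subseteq> prime_factors q \<rightarrow>\<^sub>E {0..16 * int q}"
  proof safe
    fix w p assume w: "w \<in> W1" and p: "p \<in> prime_factors q"
    have l: "ln (real w) > 0" by (rule W1[OF w])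
    have "real (multiplicity p w) / ln (real w) \<le> 2"
      using multiplicity_le_ln[of p w] p W1(2)[OF w] l by (simp add: field_simps in_prime_factors_iff)
    then have "8 * real q * (real (multiplicity p w) / ln (real w)) \<le> 8 * real q * 2"
      by (intro mult_left_mono) auto
    then show "g w p \<in> {0..16 * int q}" using p l by (simp add: g_def floor_le_iff)
  qed (auto simp: g_def)
  then have "finite (g ` W1)" by (rule finite_subset) (intro finite_PiE, auto)
  then obtain a where a: "infinite {w \<in> W1. g w = g a}"
    using pigeonhole_infinite[OF inf1] by blast
  define W2 where "W2 = {w \<in> W1. g w = g a}"
  have unb: "\<exists>w\<ge>n. w \<in> W2" for n using a by (auto simp: W2_def infinite_nat_iff_unbounded_le)
  obtain w0 where w0: "w0 \<in> W2" "w0 \<ge> K" using unb by blast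
  \<comment> \<open>The 72nd power forces \<open>\<kappa> \<ge> 9\<close> below.\<close>
  obtain w where w: "w \<in> W2" "w \<ge> w0 ^ 72" using unb by blast
  have w1: "w \<in> W1" "w0 \<in> W1" using w0 w by (auto simp: W2_def)
  note w_ge = W1(2)[OF w1(1)] W1(2)[OF w1(2)] and ln_pos = W1(3)[OF w1(1)] W1(3)[OF w1(2)]
  have "w < w0 ^ (8 * w)"
  proof -
    have "w < 2 ^ w" by (rule less_exp)
    also have "\<dots> \<le> w0 ^ w" using w_ge by (intro power_mono) auto
    also have "\<dots> \<le> w0 ^ (8 * w)" using w_ge by (intro power_increasing) auto
    finally show ?thesis .
  qed
  then have ex: "\<exists>\<kappa>. w \<le> w0 ^ (8 * \<kappa>)" by (intro exI[of _ w]) simp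
  define \<kappa> where "\<kappa> = (LEAST \<kappa>. w \<le> w0 ^ (8 * \<kappa>))"
  have \<kappa>: "w \<le> w0 ^ (8 * \<kappa>)" unfolding \<kappa>_def by (rule LeastI_ex[OF ex])
  have \<kappa>9: "\<kappa> \<ge> 9"
  proof -
    have "1 < w0" using w_ge by simp
    moreover have "w0 ^ 72 \<le> w0 ^ (8 * \<kappa>)" by (rule order_trans[OF w(2) \<kappa>])
    ultimately have "72 \<le> 8 * \<kappa>" by (rule power_le_imp_le_exp)
    then show ?thesis by simp
  qed
  have "\<not> w \<le> w0 ^ (8 * (\<kappa> - 1))"
    using not_less_Least[of "\<kappa> - 1" "\<lambda>\<kappa>. w \<le> w0 ^ (8 * \<kappa>)"] \<kappa>9 by (simp add: \<kappa>_def)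
  then have "w0 ^ (8 * (\<kappa> - 1)) * w0 ^ 8 \<le> w * w0 ^ 8" by (intro mult_right_mono) auto
  moreover have "8 * \<kappa> = 8 * (\<kappa> - 1) + 8" using \<kappa>9 by simp
  ultimately have large: "w0 ^ (8 * \<kappa>) \<le> w * w0 ^ 8" by (simp only: power_add)
  have ln_w: "ln (real w) \<le> 8 * real \<kappa> * ln (real w0)"
  proof -
    have "real w \<le> real (w0 ^ (8 * \<kappa>))" using \<kappa> by (rule of_nat_mono)
    then have "ln (real w) \<le> ln (real w0 ^ (8 * \<kappa>))" using w_ge by simp
    then show ?thesis by (simp add: ln_realpow)
  qed
  \<comment> \<open>In one grid cell, normalised exponents differ by less than
    \<open>1 / (8 * q)\<close>. So an exponent of \<open>w\<close> exceeds the rescaled one of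
    \<open>w0\<close> by less than \<open>ln w / (8 * q)\<close>, which \<open>u\<close> rounds
    up.\<close>
  define u where "u = nat \<lceil>ln (real w) / (8 * real q)\<rceil>"
  have "ln (real w) / (8 * real q) \<ge> 0" using ln_pos by simp
  then have u: "ln (real w) / (8 * real q) \<le> real u" "real u \<le> ln (real w) / (8 * real q) + 1"
    unfolding u_def by linarith+
  have dvd: "w dvd w0 ^ (8 * \<kappa>) * q ^ u"
  proof (rule multiplicity_le_imp_dvd)
    show "w \<noteq> 0" using w_ge by simp
    fix p :: nat assume p: "prime p"
    have mult: "multiplicity p (w0 ^ (8 * \<kappa>) * q ^ u) = 8 * \<kappa> * multiplicity p w0 + u * multiplicity p q"
      using p q w_ge by (simp add: prime_elem_multiplicity_mult_distrib prime_elem_multiplicity_power_distrib)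
    show "multiplicity p w \<le> multiplicity p (w0 ^ (8 * \<kappa>) * q ^ u)"
    proof (cases "p dvd q")
      case False
      have "\<not> p dvd w"
        using smooth[of w] W1(1)[OF w1(1)] False p by (meson dvd_trans prime_dvd_power)
      then show ?thesis by (simp add: not_dvd_imp_multiplicity_0)
    next
      case True
      then have pq: "p \<in> prime_factors q" using p q by (simp add: in_prime_factors_iff)
      have "g w p = g w0 p" using w0 w by (simp add: W2_def)
      then have "8 * real q * real (multiplicity p w) / ln (real w) < 8 * real q * real (multiplicity p w0) / ln (real w0) + 1"
        using pq by (simp add: g_def) linarith
      then have "(8 * real q * real (multiplicity p w) / ln (real w)) * (ln (real w) / (8 * real q)) \<le>
          (8 * real q * real (multiplicity p w0) / ln (real w0) + 1) * (ln (real w) / (8 * real q))"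
        using ln_pos by (intro mult_right_mono) auto
      moreover have "(8 * real q * real (multiplicity p w) / ln (real w)) * (ln (real w) / (8 * real q)) = real (multiplicity p w)"
        using q ln_pos by simp
      moreover have "(8 * real q * real (multiplicity p w0) / ln (real w0) + 1) * (ln (real w) / (8 * real q)) =
          real (multiplicity p w0) * (ln (real w) / ln (real w0)) + ln (real w) / (8 * real q)"
        using q ln_pos by (simp add: field_simps)
      moreover have "real (multiplicity p w0) * (ln (real w) / ln (real w0)) \<le> real (multiplicity p w0) * (8 * real \<kappa>)"
        using ln_w ln_pos by (intro mult_left_mono) (auto simp: field_simps)
      ultimately have "real (multiplicity p w) \<le> real (multiplicity p w0) * (8 * real \<kappa>) + real u"
        using u by linarith
      then have "real (multiplicity p w) \<le> real (8 * \<kappa> * multiplicity p w0 + u)" by (simp add: mult_ac)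
      then have "multiplicity p w \<le> 8 * \<kappa> * multiplicity p w0 + u" by (simp only: of_nat_le_iff)
      moreover have "u * 1 \<le> u * multiplicity p q"
        using True p q by (intro mult_left_mono) (auto simp: Suc_le_eq prime_multiplicity_gt_zero_iff)
      ultimately show ?thesis unfolding mult by linarith
    qed
  qed
  \<comment> \<open>By \<open>ln q \<le> q\<close> the factor \<open>q ^ u\<close> costs at most
    \<open>ln w / 8\<close>, hence \<open>\<kappa> * ln w0\<close>, plus \<open>ln q\<close> for the
    rounding.\<close>
  have "real u * ln (real q) \<le> ln (real q) + real \<kappa> * ln (real w0)"
  proof -
    have "ln (real q) \<le> real q" using ln_le_minus_one[of "real q"] q by simp
    have "real u * ln (real q) \<le> (ln (real w) / (8 * real q) + 1) * ln (real q)"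
      using u q by (intro mult_right_mono) auto
    also have "\<dots> = ln (real w) / 8 * (ln (real q) / real q) + ln (real q)" by (simp add: field_simps)
    also have "ln (real w) / 8 * (ln (real q) / real q) \<le> ln (real w) / 8 * 1"
      using \<open>ln (real q) \<le> real q\<close> q ln_pos by (intro mult_left_mono) auto
    finally show ?thesis using ln_w by linarith
  qed
  then have "ln (real (q ^ u)) \<le> ln (real (q * w0 ^ \<kappa>))"
    using q w_ge by (simp add: ln_realpow ln_mult)
  then have "real (q ^ u) \<le> real (q * w0 ^ \<kappa>)"
    using q w_ge by (subst (asm) ln_le_cancel_iff) auto
  then have small: "q ^ u \<le> q * w0 ^ \<kappa>" by (simp only: of_nat_le_iff)
  show thesis
    by (rule that[OF W1(1)[OF w1(2)] W1(1)[OF w1(1)] w0(2) \<kappa>9 large dvd small])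
qed

text \<open>Infinitely many solutions would include a pair as in \<open>pell_gap\<close> with
  \<open>w0\<close> beyond the bound given there.\<close>

lemma finite_smooth_pell:
  fixes D b q :: nat
  assumes "D > 0" "b > 0" "q \<ge> 2"
  shows "finite {w. (\<exists>k. w dvd q ^ k) \<and> (\<exists>Y. Y\<^sup>2 = D + b * w\<^sup>2)}" (is "finite ?W")
proof (rule ccontr)
  assume inf: "infinite ?W"
  obtain w0 w \<kappa> u where *: "w0 \<in> ?W" "w \<in> ?W" "w0 \<ge> 2 ^ 46 * D ^ 7 * (4 * b) ^ 7 * q" "\<kappa> \<ge> 9"
    "w0 ^ (8 * \<kappa>) \<le> w * w0 ^ 8" "w dvd w0 ^ (8 * \<kappa>) * q ^ u" "q ^ u \<le> q * w0 ^ \<kappa>"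
    by (rule smooth_almost_dvd_power[OF inf assms(3), of "2 ^ 46 * D ^ 7 * (4 * b) ^ 7 * q"]) (simp, rule that)
  from *(1,2) obtain Y0 Y where Y: "Y0\<^sup>2 = D + b * w0\<^sup>2" "Y\<^sup>2 = D + b * w\<^sup>2" by blast
  have "w0 > 0" "w > 0" using *(1,2) assms(3) by (auto intro!: Nat.gr0I)
  from pell_gap[OF assms(1,2) this *(4) _ Y *(5-7)] assms(3) *(3) show False by simp
qed

section \<open>Reduction of perfect codes to finitely many equations\<close>

text \<open>Only primes dividing \<open>q\<close> occur, each at most once. Hence the squarefree
  parts of ball sizes range over finitely many values.\<close>

lemma squarefree_part_dvd:
  fixes v q :: nat
  assumes "v dvd q ^ k" "q > 0"
  shows "squarefree_part v dvd q"
proof (rule multiplicity_le_imp_dvd)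
  fix p :: nat assume p: "prime p"
  show "multiplicity p (squarefree_part v) \<le> multiplicity p q"
  proof (cases "p dvd q")
    case True
    then have "1 \<le> multiplicity p q" using p assms by (simp add: Suc_le_eq prime_multiplicity_gt_zero_iff)
    then show ?thesis
      using prime_multiplicity_squarefree_part_le_Suc_0[OF p, of v] by simp
  next
    case False
    have "squarefree_part v dvd v" by (metis dvd_triv_left squarefree_decompose)
    then have "\<not> p dvd squarefree_part v"
      using False assms p by (meson dvd_trans prime_dvd_power)
    then show ?thesis by (simp add: not_dvd_imp_multiplicity_0)
  qed
qed simp

text \<open>A length determines \<open>a \<le> q\<close> and a smooth solution \<open>w\<close> of
  the equation for \<open>a\<close>. There are finitely many such pairs, and each bounds the length
  through \<open>n \<le> Y\<close>.\<close>

lemma finite_perfect_lengths: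
  fixes q :: nat
  assumes "q \<ge> 6"
  shows "finite {n. n > 0 \<and> (\<Sum>j=0..2. (n choose j) * (q - 1) ^ j) dvd q ^ n}" (is "finite ?A")
proof -
  \<comment> \<open>The shift by 6 turns \<open>(q - 3) ^ 2 - 8\<close> into the polynomial
    \<open>D\<close> in \<open>r\<close>, free of subtraction and visibly positive.\<close>
  define r where "r = q - 6"
  have q: "q = r + 6" using assms by (simp add: r_def)
  define D where "D = r\<^sup>2 + 6 * r + 1"
  define W where "W a = {w. (\<exists>k. w dvd q ^ k) \<and> (\<exists>Y. Y\<^sup>2 = D + 8 * a * w\<^sup>2)}" for a
  have "?A \<subseteq> (\<Union>a\<in>{1..q}. \<Union>w\<in>W a. {..D + 8 * a * w\<^sup>2})"
  proof safe
    fix n :: nat assume n: "n > 0" and dvd: "(\<Sum>j=0..2. (n choose j) * (q - 1) ^ j) dvd q ^ n"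
    obtain m where m: "n = m + 1" using n by (metis Suc_eq_plus1 gr0_implies_Suc)
    define v where "v = (\<Sum>j=0..2. (n choose j) * (q - 1) ^ j)"
    \<comment> \<open>With \<open>n = m + 1\<close> this is
      \<open>2 * (q - 1) * n - (q - 3)\<close>, written without subtraction.\<close>
    define Y where "Y = 2 * (r + 5) * m + r + 7"
    have tri: "2 * (n choose 2) = (m + 1) * m"
      unfolding choose_two m by simp
    have "v = 1 + n * (r + 5) + (n choose 2) * (r + 5)\<^sup>2"
      unfolding v_def q by (simp add: eval_nat_numeral)
    then have "2 * v = 2 + 2 * n * (r + 5) + (2 * (n choose 2)) * (r + 5)\<^sup>2" by simp
    then have v: "2 * v = 2 + 2 * (m + 1) * (r + 5) + (m + 1) * m * (r + 5)\<^sup>2" unfolding tri by (simp add: m)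
    have "D + 8 * v = D + 4 * (2 * v)" by simp
    also have "\<dots> = Y\<^sup>2" unfolding v by (simp add: Y_def D_def power2_eq_square algebra_simps)
    finally have Yv: "Y\<^sup>2 = D + 8 * v" ..
    define a w where "a = squarefree_part v" and "w = square_part v"
    have vaw: "v = a * w\<^sup>2" unfolding a_def w_def by (rule squarefree_decompose)
    have "a dvd q" unfolding a_def using dvd assms by (intro squarefree_part_dvd) (auto simp: v_def)
    then have a: "a \<in> {1..q}" using assms by (auto simp: dvd_imp_le Suc_le_eq intro!: Nat.gr0I)
    have "w dvd v" unfolding vaw by (simp add: power2_eq_square)
    then have "w dvd q ^ n" using dvd dvd_trans unfolding v_def by blast
    moreover have Y: "Y\<^sup>2 = D + 8 * a * w\<^sup>2" using Yv vaw by simp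
    ultimately have w: "w \<in> W a" unfolding W_def by blast
    have "1 * m \<le> 2 * (r + 5) * m" by (rule mult_right_mono) simp_all
    then have "n \<le> Y" unfolding Y_def m by linarith
    also have "Y \<le> Y\<^sup>2" by (simp add: power2_eq_square)
    finally have "n \<in> {..D + 8 * a * w\<^sup>2}" unfolding Y by simp
    then show "n \<in> (\<Union>a\<in>{1..q}. \<Union>w\<in>W a. {..D + 8 * a * w\<^sup>2})" using a w by blast
  qed
  moreover have "finite (W a)" if "a \<in> {1..q}" for a
    using finite_smooth_pell[of D "8 * a" q] that q by (simp add: W_def D_def)
  ultimately show ?thesis by (meson finite_UN_I finite_atLeastAtMost finite_atMost finite_subset)
qed

text \<open>Perfectness makes the ball size divide \<open>q ^ n\<close>, which leaves finitely many
  lengths. For each of them the codes are subsets of the finite set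
  \<open>nlists n Z\<close>.\<close>

theorem theorem3:
  fixes q :: nat and Z :: "'a set"
  assumes "q \<ge> 6" and "\<not> primepow q"
    and "finite Z" and "card Z = q"
  shows "finite {(n, C). n > 0 \<and> (\<exists>M. perfect_code Z 2 n M C)}"
proof (rule finite_subset)
  let ?A = "{n. n > 0 \<and> (\<Sum>j=0..2. (n choose j) * (q - 1) ^ j) dvd q ^ n}"
  show "{(n, C). n > 0 \<and> (\<exists>M. perfect_code Z 2 n M C)} \<subseteq> (SIGMA n:?A. Pow (nlists n Z))"
  proof
    fix x assume "x \<in> {(n, C). n > 0 \<and> (\<exists>M. perfect_code Z 2 n M C)}"
    then obtain n C M where x: "x = (n, C)" "n > 0" "perfect_code Z 2 n M C" by blast
    then have "C \<subseteq> nlists n Z" and eq: "M * (\<Sum>j=0..2. (n choose j) * (q - 1) ^ j) = q ^ n"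
      unfolding perfect_code_def error_correcting_code_def assms(4) by blast+
    moreover have "(\<Sum>j=0..2. (n choose j) * (q - 1) ^ j) dvd q ^ n"
      unfolding eq[symmetric] by (rule dvd_triv_right)
    ultimately show "x \<in> (SIGMA n:?A. Pow (nlists n Z))" using x(1,2) by blast
  qed
  have "finite (Pow (nlists n Z))" for n
  proof -
    have "nlists n Z = {xs. set xs \<subseteq> Z \<and> length xs = n}" unfolding nlists_def by blast
    then show ?thesis by (simp only: finite_Pow_iff finite_lists_length_eq[OF assms(3)])
  qed
  then show "finite (SIGMA n:?A. Pow (nlists n Z))"
    by (rule finite_SigmaI[OF finite_perfect_lengths[OF assms(1)]])
qed

end
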